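(* Let $\Omega$ be a set and $\mathcal{P}$ a (not necessarily finite) patchwork on $\Omega$. The following are equivalent: (a) $\Omega$ admits a total ordering $\leq$ under which all members of $\mathcal{P}$ are convex; (b) no three nonempty members of $\mathcal{P}$ are pairwise adjacent.
   Context: A subset $A$ of a totally ordered set $(\Omega,\leq)$ is convex if $p\leq q\leq r$ with $p,r\in A$ implies $q\in A$. Subsets $A,B\subseteq\Omega$ overlap if $A\cap B\neq\emptyset$ but neither contains the other. A patchwork on $\Omega$ is a set $\mathcal{P}$ of subsets of $\Omega$ such that $\emptyset,\Omega\in\mathcal{P}$ and for every pair of overlapping $A,B\in\mathcal{P}$, the sets $A\cap B$, $A\cup B$, $A\setminus B$ belong to $\mathcal{P}$. Two members of $\mathcal{P}$ are adjacent if they are disjoint and their union is again a member of $\mathcal{P}$. *)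

theory Defs
  imports Main
begin

definition convex_in :: "'a rel \<Rightarrow> 'a set \<Rightarrow> bool" where
  "convex_in r A \<longleftrightarrow>
     (\<forall>p q s. p \<in> A \<longrightarrow> s \<in> A \<longrightarrow> (p, q) \<in> r \<longrightarrow> (q, s) \<in> r \<longrightarrow> q \<in> A)"

definition overlap :: "'a set \<Rightarrow> 'a set \<Rightarrow> bool" where
  "overlap A B \<longleftrightarrow> A \<inter> B \<noteq> {} \<and> \<not> A \<subseteq> B \<and> \<not> B \<subseteq> A"

definition patchwork :: "'a set \<Rightarrow> 'a set set \<Rightarrow> bool" where
  "patchwork \<Omega> \<P> \<longleftrightarrow>
     \<P> \<subseteq> Pow \<Omega> \<and> {} \<in> \<P> \<and> \<Omega> \<in> \<P> \<and>
     (\<forall>A\<in>\<P>. \<forall>B\<in>\<P>. overlap A B \<longrightarrow>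
        A \<inter> B \<in> \<P> \<and> A \<union> B \<in> \<P> \<and> A - B \<in> \<P>)"

definition adjacent :: "'a set set \<Rightarrow> 'a set \<Rightarrow> 'a set \<Rightarrow> bool" where
  "adjacent \<P> A B \<longleftrightarrow> A \<in> \<P> \<and> B \<in> \<P> \<and> A \<inter> B = {} \<and> A \<union> B \<in> \<P>"

end

theory Submission
  imports Defs
begin

text \<open>
  A patchwork contains three pairwise adjacent nonempty members if and only if it contains members
  \<open>D, E, F\<close> such that any two of them meet outside the third. The absence of such a configuration
  passes to traces \<open>{A \<inter> X | A \<in> \<P>}\<close>, and so does closure under the operations on overlapping
  members. By compactness it therefore suffices to order finite ground sets.

  A finite ground set is ordered by induction, contracting to a point a minimal proper member
  \<open>A\<close> with at least two elements. If some member overlaps \<open>A\<close>, then minimality forces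
  \<open>A = {x, y}\<close>; each overlapping member leaves the contracted point to one side, and the members
  containing \<open>x\<close> all leave it to the side opposite to those containing \<open>y\<close>. This decides in which
  order \<open>x\<close> and \<open>y\<close> replace the point.
\<close>

section \<open>Properties of set families that survive restriction to a smaller ground set\<close>

definition overlap_closed :: "'a set set \<Rightarrow> bool" where
  "overlap_closed \<P> \<longleftrightarrow>
     (\<forall>A\<in>\<P>. \<forall>B\<in>\<P>. overlap A B \<longrightarrow> A \<inter> B \<in> \<P> \<and> A \<union> B \<in> \<P> \<and> A - B \<in> \<P>)"

text \<open>Chosen because it restricts to traces: each of the three inclusions survives
  intersection with a smaller ground set, whereas disjoint traces may come from members that
  meet.\<close>

definition tripod_free :: "'a set set \<Rightarrow> bool" where
  "tripod_free \<P> \<longleftrightarrow>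
     (\<forall>D\<in>\<P>. \<forall>E\<in>\<P>. \<forall>F\<in>\<P>. D \<inter> E \<subseteq> F \<or> E \<inter> F \<subseteq> D \<or> D \<inter> F \<subseteq> E)"

definition orderable :: "'a set \<Rightarrow> 'a set set \<Rightarrow> bool" where
  "orderable X \<P> \<longleftrightarrow> (\<exists>r. linear_order_on X r \<and> (\<forall>A\<in>\<P>. convex_in r A))"

section \<open>Linear orders and convex sets\<close>

lemma convex_inD:
  "convex_in r A \<Longrightarrow> p \<in> A \<Longrightarrow> s \<in> A \<Longrightarrow> (p, q) \<in> r \<Longrightarrow> (q, s) \<in> r \<Longrightarrow> q \<in> A"
  unfolding convex_in_def by blast

lemma linear_order_onD:
  assumes "linear_order_on X r"
  shows linear_order_on_dom: "(p, q) \<in> r \<Longrightarrow> p \<in> X \<and> q \<in> X"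
    and linear_order_on_refl: "p \<in> X \<Longrightarrow> (p, p) \<in> r"
    and linear_order_on_trans: "(p, q) \<in> r \<Longrightarrow> (q, s) \<in> r \<Longrightarrow> (p, s) \<in> r"
    and linear_order_on_antisym: "(p, q) \<in> r \<Longrightarrow> (q, p) \<in> r \<Longrightarrow> p = q"
    and linear_order_on_total: "p \<in> X \<Longrightarrow> q \<in> X \<Longrightarrow> (p, q) \<in> r \<or> (q, p) \<in> r"
proof -
  have sub: "r \<subseteq> X \<times> X" and "refl_on X r" "trans r" "antisym r" and total: "total_on X r"
    using assms unfolding linear_order_on_def partial_order_on_def preorder_on_def by blast+
  then show "(p, q) \<in> r \<Longrightarrow> p \<in> X \<and> q \<in> X" and refl: "\<And>p. p \<in> X \<Longrightarrow> (p, p) \<in> r"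
    and "(p, q) \<in> r \<Longrightarrow> (q, s) \<in> r \<Longrightarrow> (p, s) \<in> r" "(p, q) \<in> r \<Longrightarrow> (q, p) \<in> r \<Longrightarrow> p = q"
    by (auto dest: refl_onD transD antisymD)
  show "(p, q) \<in> r \<or> (q, p) \<in> r" if "p \<in> X" "q \<in> X"
    using that refl total unfolding total_on_def by metis
qed

lemma linear_order_onI:
  assumes "r \<subseteq> X \<times> X"
    and "\<And>p q s. (p, q) \<in> r \<Longrightarrow> (q, s) \<in> r \<Longrightarrow> (p, s) \<in> r"
    and "\<And>p q. (p, q) \<in> r \<Longrightarrow> (q, p) \<in> r \<Longrightarrow> p = q"
    and "\<And>p q. p \<in> X \<Longrightarrow> q \<in> X \<Longrightarrow> (p, q) \<in> r \<or> (q, p) \<in> r"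
  shows "linear_order_on X r"
  using assms
  unfolding linear_order_on_def partial_order_on_def preorder_on_def
    refl_on_def total_on_def trans_def antisym_def
  by blast

lemma linear_order_on_Restr:
  assumes "linear_order_on X r" "Y \<subseteq> X"
  shows "linear_order_on Y (r \<inter> Y \<times> Y)"
  using assms(2) linear_order_onD[OF assms(1)] by (intro linear_order_onI) blast+

lemma convex_in_converse: "convex_in (r\<inverse>) A \<longleftrightarrow> convex_in r A"
  unfolding convex_in_def by blast

lemma convex_in_subset: "convex_in r A \<Longrightarrow> s \<subseteq> r \<Longrightarrow> convex_in s A"
  unfolding convex_in_def by blast

lemma convex_in_subsingleton:
  assumes "linear_order_on X r" "\<And>p q. p \<in> A \<Longrightarrow> q \<in> A \<Longrightarrow> p = q"
  shows "convex_in r A"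
  unfolding convex_in_def
  using assms(2) linear_order_on_antisym[OF assms(1)] by blast

lemma linear_order_on_exists_with:
  assumes "x \<in> X" "y \<in> X"
  obtains t where "linear_order_on X t" "(x, y) \<in> t"
proof -
  obtain t where t: "linear_order_on X t"
    using well_order_on unfolding well_order_on_def by blast
  show thesis
  proof (cases "(x, y) \<in> t")
    case True
    then show ?thesis using t that by blast
  next
    case False
    then have "(x, y) \<in> t\<inverse>"
      using linear_order_on_total[OF t assms] by blast
    then show ?thesis using t that[of "t\<inverse>"] by simp
  qed
qed

text \<open>A lexicographic order: points are compared by their images under \<open>h\<close> first,
  and by \<open>t\<close> inside a fibre. Every fibre becomes an interval, which undoes the
  contraction of that fibre to a point.\<close>

lemma linear_order_on_blowup:
  assumes r: "linear_order_on Y r" and t: "linear_order_on X t" and h: "h ` X \<subseteq> Y"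
  shows "linear_order_on X
    {(p, q) \<in> X \<times> X. if h p = h q then (p, q) \<in> t else (h p, h q) \<in> r}" (is "linear_order_on X ?R")
proof (rule linear_order_onI)
  show "?R \<subseteq> X \<times> X" by auto
  show "(p, s) \<in> ?R" if "(p, q) \<in> ?R" "(q, s) \<in> ?R" for p q s
    using that linear_order_on_trans[OF r, of "h p" "h q" "h s"]
      linear_order_on_antisym[OF r, of "h p" "h q"] linear_order_on_trans[OF t, of p q s]
    by (auto split: if_splits)
  show "p = q" if "(p, q) \<in> ?R" "(q, p) \<in> ?R" for p q
    using that linear_order_on_antisym[OF r] linear_order_on_antisym[OF t]
    by (auto split: if_splits)
  show "(p, q) \<in> ?R \<or> (q, p) \<in> ?R" if "p \<in> X" "q \<in> X" for p q
    using that h linear_order_on_total[OF r, of "h p" "h q"] linear_order_on_total[OF t, of p q]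
    by (auto split: if_splits)
qed

section \<open>Traces and contractions of families\<close>

text \<open>Overlapping traces come from overlapping members, and intersecting with \<open>X\<close>
  commutes with the three set operations.\<close>

lemma overlap_closed_trace:
  assumes "overlap_closed \<P>"
  shows "overlap_closed ((\<lambda>A. A \<inter> X) ` \<P>)"
  unfolding overlap_closed_def
proof (intro ballI impI)
  fix S T assume "S \<in> (\<lambda>A. A \<inter> X) ` \<P>" "T \<in> (\<lambda>A. A \<inter> X) ` \<P>" and ov: "overlap S T"
  then obtain A B where A: "A \<in> \<P>" "S = A \<inter> X" and B: "B \<in> \<P>" "T = B \<inter> X"
    by blast
  from ov have "overlap A B" unfolding A B overlap_def by blast
  then have "A \<inter> B \<in> \<P>" "A \<union> B \<in> \<P>" "A - B \<in> \<P>"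
    using assms A(1) B(1) unfolding overlap_closed_def by blast+
  moreover have "S \<inter> T = (A \<inter> B) \<inter> X" "S \<union> T = (A \<union> B) \<inter> X" "S - T = (A - B) \<inter> X"
    unfolding A B by blast+
  ultimately show "S \<inter> T \<in> (\<lambda>A. A \<inter> X) ` \<P> \<and> S \<union> T \<in> (\<lambda>A. A \<inter> X) ` \<P> \<and>
      S - T \<in> (\<lambda>A. A \<inter> X) ` \<P>"
    by blast
qed

lemma tripod_free_trace:
  assumes "tripod_free \<P>"
  shows "tripod_free ((\<lambda>A. A \<inter> X) ` \<P>)"
  unfolding tripod_free_def
proof (intro ballI)
  fix S T U
  assume "S \<in> (\<lambda>A. A \<inter> X) ` \<P>" "T \<in> (\<lambda>A. A \<inter> X) ` \<P>" "U \<in> (\<lambda>A. A \<inter> X) ` \<P>"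
  then obtain D E F where "D \<in> \<P>" "E \<in> \<P>" "F \<in> \<P>"
    and eq: "S = D \<inter> X" "T = E \<inter> X" "U = F \<inter> X"
    by blast
  then have "D \<inter> E \<subseteq> F \<or> E \<inter> F \<subseteq> D \<or> D \<inter> F \<subseteq> E"
    using assms unfolding tripod_free_def by blast
  then show "S \<inter> T \<subseteq> U \<or> T \<inter> U \<subseteq> S \<or> S \<inter> U \<subseteq> T"
    unfolding eq by blast
qed

text \<open>To contain all of \<open>A\<close> or nothing of it is stable under intersection, union
  and difference. Such members do not notice that \<open>A\<close> is contracted to a point.\<close>

lemma overlap_closed_nonoverlapping:
  assumes "overlap_closed \<P>"
  shows "overlap_closed {B \<in> \<P>. B \<inter> A = {} \<or> A \<subseteq> B}"
  unfolding overlap_closed_def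
proof (intro ballI impI)
  fix S T
  assume S: "S \<in> {B \<in> \<P>. B \<inter> A = {} \<or> A \<subseteq> B}"
    and T: "T \<in> {B \<in> \<P>. B \<inter> A = {} \<or> A \<subseteq> B}" and ov: "overlap S T"
  then have "S \<inter> T \<in> \<P>" "S \<union> T \<in> \<P>" "S - T \<in> \<P>"
    using assms unfolding overlap_closed_def by blast+
  with S T show "S \<inter> T \<in> {B \<in> \<P>. B \<inter> A = {} \<or> A \<subseteq> B} \<and>
      S \<union> T \<in> {B \<in> \<P>. B \<inter> A = {} \<or> A \<subseteq> B} \<and> S - T \<in> {B \<in> \<P>. B \<inter> A = {} \<or> A \<subseteq> B}"
    by (intro conjI CollectI; blast)
qed

lemma tripod_free_subset: "tripod_free \<P> \<Longrightarrow> \<Q> \<subseteq> \<P> \<Longrightarrow> tripod_free \<Q>"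
  unfolding tripod_free_def by blast

section \<open>Intervals to one side of a point, and minimal members\<close>

lemma convex_in_one_side:
  assumes "linear_order_on X r" "convex_in r I" "I \<subseteq> X" "x \<in> X" "x \<notin> I"
  shows "(\<forall>i\<in>I. (i, x) \<in> r) \<or> (\<forall>i\<in>I. (x, i) \<in> r)"
  using assms(2-) linear_order_on_total[OF assms(1)] unfolding convex_in_def by blast

text \<open>Of one element of \<open>I\<close> and one of \<open>J\<close>, the one closer to
  \<open>x\<close> lies between the other and \<open>x\<close>, hence in both sets.\<close>

lemma convex_in_same_side_meet:
  assumes "linear_order_on X r" "convex_in r (insert x I)" "convex_in r (insert x J)"
    and "I \<subseteq> X" "J \<subseteq> X" "I \<noteq> {}" "J \<noteq> {}" "x \<notin> I" "x \<notin> J"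
    and "\<forall>i\<in>I. (i, x) \<in> r" "\<forall>j\<in>J. (j, x) \<in> r"
  shows "I \<inter> J \<noteq> {}"
proof -
  obtain i j where ij: "i \<in> I" "j \<in> J" using assms(6,7) by blast
  then consider "(i, j) \<in> r" | "(j, i) \<in> r"
    using assms(4,5) linear_order_on_total[OF assms(1)] by blast
  then show ?thesis
  proof cases
    case 1
    then have "j \<in> insert x I"
      using convex_inD[OF assms(2), of i x j] ij assms(11) by blast
    then show ?thesis using ij assms(9) by blast
  next
    case 2
    then have "i \<in> insert x J"
      using convex_inD[OF assms(3), of j x i] ij assms(10) by blast
    then show ?thesis using ij assms(8) by blast
  qed
qed

text \<open>Overlap splits \<open>A\<close> into \<open>A \<inter> B\<close> and
  \<open>A - B\<close>, both nonempty members properly inside \<open>A\<close>, so minimality makes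
  each a single point.\<close>

lemma overlap_minimal_eq:
  assumes cl: "overlap_closed \<P>" and AB: "A \<in> \<P>" "B \<in> \<P>" "overlap A B"
    and min: "\<And>B p q. B \<in> \<P> \<Longrightarrow> B \<subset> A \<Longrightarrow> p \<in> B \<Longrightarrow> q \<in> B \<Longrightarrow> p = q"
    and x: "x \<in> A \<inter> B"
  obtains y where "A = {x, y}" "y \<noteq> x" "y \<notin> B"
proof -
  have P: "A \<inter> B \<in> \<P>" "A - B \<in> \<P>"
    using cl AB unfolding overlap_closed_def by blast+
  obtain y where y: "y \<in> A - B" using AB(3) unfolding overlap_def by blast
  have "A \<inter> B \<subset> A" "A - B \<subset> A" using x y by blast+
  then have "\<And>z. z \<in> A \<inter> B \<Longrightarrow> z = x" "\<And>z. z \<in> A - B \<Longrightarrow> z = y"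
    using min[OF P(1)] min[OF P(2)] x y by blast+
  then have "A = {x, y}" using x y by blast
  then show thesis using that x y by blast
qed

section \<open>Finite ground sets\<close>

lemma orderable_finite:
  assumes "finite X" "\<P> \<subseteq> Pow X" "overlap_closed \<P>" "tripod_free \<P>"
  shows "orderable X \<P>"
  using assms
proof (induction X arbitrary: \<P> rule: finite_psubset_induct)
  case (psubset X)
  note sub = psubset.prems(1) and cl = psubset.prems(2) and tf = psubset.prems(3)
  let ?big = "\<lambda>A. A \<in> \<P> \<and> A \<noteq> X \<and> (\<exists>p\<in>A. \<exists>q\<in>A. p \<noteq> q)"
  show ?case
  proof (cases "\<exists>A. ?big A")
    case False
    obtain t where t: "linear_order_on X t"
      using well_order_on unfolding well_order_on_def by blast
    have "convex_in t A" if "A \<in> \<P>" for A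
    proof (cases "A = X")
      case True
      then show ?thesis using linear_order_on_dom[OF t] unfolding convex_in_def by blast
    next
      case False
      then have "\<And>p q. p \<in> A \<Longrightarrow> q \<in> A \<Longrightarrow> p = q" using that \<open>\<not> (\<exists>A. ?big A)\<close> by blast
      then show ?thesis by (rule convex_in_subsingleton[OF t])
    qed
    then show ?thesis using t unfolding orderable_def by blast
  next
    case True
    have "finite {A. ?big A}"
      by (rule finite_subset[of _ "Pow X"]) (use sub psubset.hyps in auto)
    moreover have "{A. ?big A} \<noteq> {}" using True by blast
    ultimately have "\<exists>A\<in>{A. ?big A}. \<forall>B\<in>{A. ?big A}. B \<subseteq> A \<longrightarrow> A = B"
      by (rule finite_has_minimal)
    then obtain A where "A \<in> {A. ?big A}" and min': "\<forall>B\<in>{A. ?big A}. B \<subseteq> A \<longrightarrow> A = B"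
      by (rule bexE)
    then have A: "?big A" by simp
    have AX: "A \<subseteq> X" using A sub by blast
    have min: "p = q" if "B \<in> \<P>" "B \<subset> A" "p \<in> B" "q \<in> B" for B p q
    proof (rule ccontr)
      assume "p \<noteq> q"
      with that A AX have "?big B" by blast
      then show False using min' that(2) by blast
    qed
    \<comment> \<open>The members that survive the contraction of \<open>A\<close>. Every other
      member lies properly inside \<open>A\<close> or overlaps it.\<close>
    define \<Q> where "\<Q> = {B \<in> \<P>. B \<inter> A = {} \<or> A \<subseteq> B}"
    \<comment> \<open>The contraction is realized within \<open>X\<close>: a point \<open>x\<close>
      represents \<open>A\<close> and the rest of \<open>A\<close> is deleted. This turns
      contracting into taking traces, so the induction hypothesis applies.\<close>
    have contract: "\<exists>r. linear_order_on (X - (A - {x})) r \<and>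
        (\<forall>B\<in>\<Q>. convex_in r (B \<inter> (X - (A - {x}))))" if "x \<in> A" for x
    proof -
      let ?Y = "X - (A - {x})"
      have "?Y \<subset> X" using A AX by blast
      moreover have "overlap_closed ((\<lambda>B. B \<inter> ?Y) ` \<Q>)"
        unfolding \<Q>_def by (intro overlap_closed_trace overlap_closed_nonoverlapping cl)
      moreover have "tripod_free ((\<lambda>B. B \<inter> ?Y) ` \<Q>)"
        by (intro tripod_free_trace tripod_free_subset[OF tf]) (auto simp: \<Q>_def)
      ultimately have "orderable ?Y ((\<lambda>B. B \<inter> ?Y) ` \<Q>)"
        by (intro psubset.IH) auto
      then show ?thesis unfolding orderable_def by blast
    qed
    show ?thesis
    proof (cases "\<exists>B\<in>\<P>. overlap A B")
      case False
      obtain x where x: "x \<in> A" using A by blast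
      define h where "h z = (if z \<in> A then x else z)" for z
      let ?Y = "X - (A - {x})"
      obtain r where r: "linear_order_on ?Y r" and conv: "\<And>B. B \<in> \<Q> \<Longrightarrow> convex_in r (B \<inter> ?Y)"
        using contract[OF x] by blast
      \<comment> \<open>Any order inside \<open>A\<close> will do: with no member overlapping
        \<open>A\<close>, the members outside \<open>\<Q>\<close> lie properly inside
        \<open>A\<close> and have at most one point.\<close>
      obtain t where t: "linear_order_on X t"
        using well_order_on unfolding well_order_on_def by blast
      define R where "R = {(p, q) \<in> X \<times> X. if h p = h q then (p, q) \<in> t else (h p, h q) \<in> r}"
      have h: "h ` X \<subseteq> ?Y" using x AX unfolding h_def by auto
      have R: "linear_order_on X R"
        unfolding R_def by (rule linear_order_on_blowup[OF r t h])
      have Rr: "(h p, h q) \<in> r" "p \<in> X" "q \<in> X" if "(p, q) \<in> R" for p q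
        using that h linear_order_on_refl[OF r, of "h p"] unfolding R_def
        by (auto split: if_splits)
      have "convex_in R B" if B: "B \<in> \<P>" for B
      proof (cases "B \<in> \<Q>")
        case True
        \<comment> \<open>Members of \<open>\<Q>\<close> are unions of fibres of \<open>h\<close>,
          so their convexity pulls back along \<open>h\<close>.\<close>
        have hB: "h z \<in> B \<longleftrightarrow> z \<in> B" for z
          using True x unfolding \<Q>_def h_def by auto
        show ?thesis
          unfolding convex_in_def
        proof (intro allI impI)
          fix p q s assume ps: "p \<in> B" "s \<in> B" and pq: "(p, q) \<in> R" and qs: "(q, s) \<in> R"
          have "h p \<in> B \<inter> ?Y" "h s \<in> B \<inter> ?Y"
            using ps hB h Rr(2)[OF pq] Rr(3)[OF qs] by blast+
          then have "h q \<in> B"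
            using convex_inD[OF conv[OF True]] Rr(1)[OF pq] Rr(1)[OF qs] by blast
          then show "q \<in> B" using hB by blast
        qed
      next
        case notQ: False
        then have "B \<subset> A"
          using B False unfolding \<Q>_def overlap_def by blast
        then show ?thesis using min[OF B] by (intro convex_in_subsingleton[OF R])
      qed
      then show ?thesis using R unfolding orderable_def by blast
    next
      case True
      then obtain B0 where B0: "B0 \<in> \<P>" "overlap A B0" by blast
      then obtain x where x: "x \<in> A \<inter> B0" unfolding overlap_def by blast
      have "A \<in> \<P>" using A by blast
      from cl this B0 min x obtain y where Axy: "A = {x, y}" and y: "y \<noteq> x" "y \<notin> B0"
        by (rule overlap_minimal_eq)
      let ?Y = "X - {y}"
      have Yeq: "X - (A - {x}) = ?Y" using Axy y by blast
      have xX: "x \<in> ?Y" and yX: "y \<in> X" using AX Axy y by blast+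
      \<comment> \<open>A member \<open>B\<close> overlapping \<open>A\<close> is not in
        \<open>\<Q>\<close>, but \<open>A \<union> B\<close> and \<open>B - A\<close> are. After the
        contraction they become intervals with and without the point \<open>x\<close>, so
        \<open>B - A\<close> lies on one side of \<open>x\<close>.\<close>
      have ovQ: "insert x (B - A) = (A \<union> B) \<inter> ?Y" "B - A = (B - A) \<inter> ?Y"
          "A \<union> B \<in> \<Q>" "B - A \<in> \<Q>" "B - A \<noteq> {}" "B \<subseteq> X"
        if "B \<in> \<P>" "overlap A B" for B
      proof -
        have BX: "B \<subseteq> X" using that sub by blast
        then show "insert x (B - A) = (A \<union> B) \<inter> ?Y" "B - A = (B - A) \<inter> ?Y" "B \<subseteq> X"
          using Axy AX y by auto
        have "overlap B A" using that unfolding overlap_def by blast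
        then have "A \<union> B \<in> \<P>" "B - A \<in> \<P>"
          using cl that A unfolding overlap_closed_def by blast+
        then show "A \<union> B \<in> \<Q>" "B - A \<in> \<Q>" unfolding \<Q>_def by blast+
        show "B - A \<noteq> {}" using that unfolding overlap_def by blast
      qed
      obtain r0 where r0: "linear_order_on ?Y r0"
        and conv0: "\<And>B. B \<in> \<Q> \<Longrightarrow> convex_in r0 (B \<inter> ?Y)"
        using contract[of x] x unfolding Yeq by blast
      have side0: "(\<forall>i\<in>B0 - A. (i, x) \<in> r0) \<or> (\<forall>i\<in>B0 - A. (x, i) \<in> r0)"
      proof (rule convex_in_one_side[OF r0 _ _ xX])
        show "convex_in r0 (B0 - A)" using ovQ[OF B0] conv0 by metis
        show "B0 - A \<subseteq> ?Y" "x \<notin> B0 - A" using ovQ(2)[OF B0] x by blast+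
      qed
      \<comment> \<open>Reversing the order if necessary puts \<open>B0 - A\<close> to the left of
        \<open>x\<close>.\<close>
      obtain r where r: "linear_order_on ?Y r" and conv: "\<And>B. B \<in> \<Q> \<Longrightarrow> convex_in r (B \<inter> ?Y)"
        and left0: "\<forall>i\<in>B0 - A. (i, x) \<in> r"
      proof (cases "\<forall>i\<in>B0 - A. (i, x) \<in> r0")
        case True
        then show ?thesis using that r0 conv0 by blast
      next
        case False
        then show ?thesis
          using that[of "r0\<inverse>"] r0 conv0 side0 by (auto simp: convex_in_converse)
      qed
      \<comment> \<open>Only the fibre \<open>{x, y}\<close> of \<open>h\<close> has two points. As
        \<open>B0\<close> contains \<open>x\<close> but not \<open>y\<close> and extends to the
        left, \<open>y\<close> must come after \<open>x\<close>.\<close>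
      obtain t where t: "linear_order_on X t" and xy: "(x, y) \<in> t"
        using linear_order_on_exists_with[of x X y] xX yX by blast
      define h where "h z = (if z = y then x else z)" for z
      define R where "R = {(p, q) \<in> X \<times> X. if h p = h q then (p, q) \<in> t else (h p, h q) \<in> r}"
      have h: "h ` X \<subseteq> ?Y" using xX y unfolding h_def by auto
      have R: "linear_order_on X R"
        unfolding R_def by (rule linear_order_on_blowup[OF r t h])
      have Rr: "(h p, h q) \<in> r" "p \<in> X" "q \<in> X" if "(p, q) \<in> R" for p q
        using that h linear_order_on_refl[OF r, of "h p"] unfolding R_def
        by (auto split: if_splits)
      have yx: "(y, x) \<notin> R"
        using xy y linear_order_on_antisym[OF t] unfolding R_def h_def by auto
      have hconv: "h q \<in> C" if "C \<in> \<Q>" "p \<in> C" "s \<in> C" "(p, q) \<in> R" "(q, s) \<in> R" for C p q s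
      proof -
        have "h p \<in> C \<inter> ?Y" "h s \<in> C \<inter> ?Y"
          using that h Rr(2)[OF that(4)] Rr(3)[OF that(5)] Axy
          unfolding \<Q>_def h_def by auto
        then show ?thesis
          using convex_inD[OF conv[OF that(1)]] Rr(1)[OF that(4)] Rr(1)[OF that(5)] by blast
      qed
      have side: "(\<forall>i\<in>B - A. (i, x) \<in> r) \<or> (\<forall>i\<in>B - A. (x, i) \<in> r)"
        if B: "B \<in> \<P>" "overlap A B" for B
      proof (rule convex_in_one_side[OF r _ _ xX])
        show "convex_in r (B - A)" using ovQ[OF B] conv by metis
        show "B - A \<subseteq> ?Y" "x \<notin> B - A" using ovQ(2)[OF B] x by blast+
      qed
      \<comment> \<open>If \<open>B - A\<close> and \<open>B0 - A\<close> were disjoint, then \<open>B \<union> B0\<close>, \<open>A \<union> B\<close>, \<open>A \<union> B0\<close> would violate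
        \<open>tripod_free\<close>.\<close>
      have left: "(i, x) \<in> r" if B: "B \<in> \<P>" "overlap A B" "x \<in> B" and i: "i \<in> B - A" for B i
      proof -
        have "overlap B B0 \<or> (B - A) \<inter> (B0 - A) \<noteq> {}"
          using x B(3) ovQ(5)[OF B(1,2)] ovQ(5)[OF B0] unfolding overlap_def by blast
        moreover have "B \<union> B0 \<in> \<P>" "A \<union> B \<in> \<P>" "A \<union> B0 \<in> \<P>" if "overlap B B0"
          using that ovQ(3)[OF B(1,2)] ovQ(3)[OF B0] cl B(1) B0(1)
          unfolding overlap_closed_def \<Q>_def by blast+
        moreover have "y \<notin> B" using B(2,3) Axy unfolding overlap_def by blast
        ultimately obtain z where z: "z \<in> B - A" "z \<in> B0 - A"
          using tf[unfolded tripod_free_def, rule_format, of "B \<union> B0" "A \<union> B" "A \<union> B0"]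
            ovQ(5)[OF B(1,2)] ovQ(5)[OF B0] y Axy by blast
        then have "(z, x) \<in> r" "z \<noteq> x" using left0 x by blast+
        then have "\<not> (\<forall>i\<in>B - A. (x, i) \<in> r)"
          using z linear_order_on_antisym[OF r] by blast
        then show ?thesis using side[OF B(1,2)] i by blast
      qed
      \<comment> \<open>Here \<open>B\<close> meets \<open>A\<close> in \<open>y\<close> alone and
        \<open>B0\<close> meets it in \<open>x\<close> alone. A common point of \<open>B\<close> and
        \<open>B0\<close> outside \<open>A\<close> would make \<open>A\<close>, \<open>B\<close>,
        \<open>B0\<close> violate \<open>tripod_free\<close>. Hence \<open>B - A\<close> and
        \<open>B0 - A\<close> are disjoint, and they cannot both be on the left of
        \<open>x\<close>.\<close>
      have right: "(x, i) \<in> r" if B: "B \<in> \<P>" "overlap A B" "y \<in> B" and i: "i \<in> B - A" for B i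
      proof -
        have "x \<notin> B" using B(2,3) Axy unfolding overlap_def by blast
        then have "(B - A) \<inter> (B0 - A) = {}"
          using tf[unfolded tripod_free_def, rule_format, of A B B0] A B(1,3) B0(1) x y Axy by blast
        moreover have "convex_in r (insert x (B - A))" "convex_in r (insert x (B0 - A))"
          using ovQ(1,3)[OF B(1,2)] ovQ(1,3)[OF B0] conv by metis+
        moreover have "B - A \<subseteq> ?Y" "B0 - A \<subseteq> ?Y"
          using ovQ(2)[OF B(1,2)] ovQ(2)[OF B0] by blast+
        ultimately have "\<not> (\<forall>i\<in>B - A. (i, x) \<in> r)"
          using convex_in_same_side_meet[OF r, of x "B - A" "B0 - A"] left0
            ovQ(5)[OF B(1,2)] ovQ(5)[OF B0] x by blast
        then show ?thesis using side[OF B(1,2)] i by blast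
      qed
      have "convex_in R B" if B: "B \<in> \<P>" for B
      proof -
        consider "B \<in> \<Q>" | "B \<subset> A" | "overlap A B" "x \<in> B" | "overlap A B" "y \<in> B" "x \<notin> B"
          using B Axy unfolding \<Q>_def overlap_def by blast
        then show ?thesis
        proof cases
          case 1
          have "h z \<in> B \<longleftrightarrow> z \<in> B" for z
            using 1 Axy unfolding \<Q>_def h_def by auto
          then show ?thesis using hconv[OF 1] unfolding convex_in_def by blast
        next
          case 2
          then show ?thesis using min[OF B] by (intro convex_in_subsingleton[OF R])
        next
          case 3
          show ?thesis
            unfolding convex_in_def
          proof (intro allI impI)
            fix p q s assume ps: "p \<in> B" "s \<in> B" and pq: "(p, q) \<in> R" and qs: "(q, s) \<in> R"
            have yB: "y \<notin> B" using 3 Axy unfolding overlap_def by blast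
            \<comment> \<open>Since \<open>A \<union> B\<close> is in \<open>\<Q>\<close>, only its
              point \<open>y\<close> outside \<open>B\<close> could break convexity. An element of
              \<open>B\<close> above \<open>y\<close> would lie in \<open>B - A\<close> and to the
              right of \<open>x\<close>, against \<open>left\<close>.\<close>
            have "q \<noteq> y"
            proof
              assume "q = y"
              then have "s \<noteq> x" using yx qs by blast
              then have s: "s \<in> B - A" using ps yB Axy by blast
              have "(x, s) \<in> r"
                using Rr(1)[OF qs] \<open>q = y\<close> s Axy unfolding h_def by auto
              then show False
                using left[OF B 3 s] linear_order_on_antisym[OF r] \<open>s \<noteq> x\<close> by blast
            qed
            then have "q \<in> A \<union> B"
              using hconv[OF ovQ(3)[OF B 3(1)] _ _ pq qs] ps unfolding h_def by auto
            then show "q \<in> B" using \<open>q \<noteq> y\<close> Axy 3 by blast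
          qed
        next
          case 4
          show ?thesis
            unfolding convex_in_def
          proof (intro allI impI)
            fix p q s assume ps: "p \<in> B" "s \<in> B" and pq: "(p, q) \<in> R" and qs: "(q, s) \<in> R"
            \<comment> \<open>Dually, \<open>x\<close> is the only point of
              \<open>A \<union> B\<close> outside \<open>B\<close>, and an element of
              \<open>B\<close> below \<open>x\<close> would contradict \<open>right\<close>.\<close>
            have "q \<noteq> x"
            proof
              assume "q = x"
              then have "p \<noteq> y" using yx pq by blast
              then have p: "p \<in> B - A" using ps 4 Axy by blast
              have "(p, x) \<in> r"
                using Rr(1)[OF pq] \<open>q = x\<close> p Axy y unfolding h_def by (auto split: if_splits)
              then show False
                using right[OF B 4(1,2) p] linear_order_on_antisym[OF r] p Axy by blast
            qed
            moreover have "q \<in> A \<union> B"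
              using hconv[OF ovQ(3)[OF B 4(1)] _ _ pq qs] ps Axy
              unfolding h_def by (auto split: if_splits)
            ultimately show "q \<in> B" using Axy 4 by blast
          qed
        qed
      qed
      then show ?thesis using R unfolding orderable_def by blast
    qed
  qed
qed

section \<open>From finite to arbitrary ground sets\<close>

text \<open>The compactness argument: a maximal extendable relation is the desired order.\<close>

definition extendable :: "'a set \<Rightarrow> 'a set set \<Rightarrow> 'a rel \<Rightarrow> bool" where
  "extendable \<Omega> \<P> L \<longleftrightarrow> L \<subseteq> \<Omega> \<times> \<Omega> \<and>
     (\<forall>X. finite X \<and> X \<subseteq> \<Omega> \<longrightarrow>
       (\<exists>r. linear_order_on X r \<and> L \<inter> X \<times> X \<subseteq> r \<and> (\<forall>A\<in>\<P>. convex_in r A)))"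

lemma extendableD:
  assumes "extendable \<Omega> \<P> L" "finite X" "X \<subseteq> \<Omega>"
  obtains r where "linear_order_on X r" "L \<inter> X \<times> X \<subseteq> r" "\<And>A. A \<in> \<P> \<Longrightarrow> convex_in r A"
proof -
  have "\<exists>r. linear_order_on X r \<and> L \<inter> X \<times> X \<subseteq> r \<and> (\<forall>A\<in>\<P>. convex_in r A)"
    using assms unfolding extendable_def by simp
  then show thesis using that by auto
qed

text \<open>Only finitely many pairs of the union lie in \<open>X \<times> X\<close>, so a single
  member of the chain contains them all.\<close>

lemma extendable_Union_chain:
  assumes "subset.chain {L. extendable \<Omega> \<P> L} \<C>" "\<C> \<noteq> {}"
  shows "extendable \<Omega> \<P> (\<Union>\<C>)"
  unfolding extendable_def
proof (intro conjI allI impI)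
  have ext: "\<And>L. L \<in> \<C> \<Longrightarrow> extendable \<Omega> \<P> L"
    using assms(1) unfolding subset.chain_def by blast
  then show "\<Union>\<C> \<subseteq> \<Omega> \<times> \<Omega>" unfolding extendable_def by blast
  fix X assume X: "finite X \<and> X \<subseteq> \<Omega>"
  then have "finite (\<Union>\<C> \<inter> X \<times> X)" by blast
  then obtain L where L: "L \<in> \<C>" "\<Union>\<C> \<inter> X \<times> X \<subseteq> L"
    by (rule finite_subset_Union_chain[OF _ Int_lower1 assms(2,1)])
  then obtain r where "linear_order_on X r" "L \<inter> X \<times> X \<subseteq> r" "\<forall>A\<in>\<P>. convex_in r A"
    using X ext[OF L(1)] unfolding extendable_def by blast
  then show "\<exists>r. linear_order_on X r \<and> \<Union>\<C> \<inter> X \<times> X \<subseteq> r \<and> (\<forall>A\<in>\<P>. convex_in r A)"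
    using L(2) by blast
qed

text \<open>If the two insertions failed on finite sets \<open>X\<close> and \<open>Y\<close>, an
  order on their union together with \<open>p\<close> and \<open>q\<close> would still compare
  \<open>p\<close> with \<open>q\<close> one way or the other. Its restriction to \<open>X\<close>
  or to \<open>Y\<close> then contradicts the failure there.\<close>

lemma extendable_insert:
  assumes L: "extendable \<Omega> \<P> L" and pq: "p \<in> \<Omega>" "q \<in> \<Omega>"
  shows "extendable \<Omega> \<P> (insert (p, q) L) \<or> extendable \<Omega> \<P> (insert (q, p) L)"
proof (rule ccontr)
  assume contra: "\<not> ?thesis"
  let ?bad = "\<lambda>X M. finite X \<and> X \<subseteq> \<Omega> \<and>
    \<not> (\<exists>r. linear_order_on X r \<and> M \<inter> X \<times> X \<subseteq> r \<and> (\<forall>A\<in>\<P>. convex_in r A))"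
  have sub: "insert (p, q) L \<subseteq> \<Omega> \<times> \<Omega>" "insert (q, p) L \<subseteq> \<Omega> \<times> \<Omega>"
    using L pq unfolding extendable_def by auto
  obtain X where X: "?bad X (insert (p, q) L)"
    using contra sub(1) unfolding extendable_def by blast
  obtain Y where Y: "?bad Y (insert (q, p) L)"
    using contra sub(2) unfolding extendable_def by blast
  let ?Z = "insert p (insert q (X \<union> Y))"
  obtain r where r: "linear_order_on ?Z r" "L \<inter> ?Z \<times> ?Z \<subseteq> r" "\<And>A. A \<in> \<P> \<Longrightarrow> convex_in r A"
    using extendableD[OF L, of ?Z] X Y pq by auto
  have restr: "linear_order_on W (r \<inter> W \<times> W)" "\<forall>A\<in>\<P>. convex_in (r \<inter> W \<times> W) A"
    if "W \<subseteq> ?Z" for W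
    using linear_order_on_Restr[OF r(1) that] r(3) convex_in_subset by blast+
  consider "(p, q) \<in> r" | "(q, p) \<in> r"
    using linear_order_on_total[OF r(1), of p q] by blast
  then show False
  proof cases
    case 1
    then have "insert (p, q) L \<inter> X \<times> X \<subseteq> r \<inter> X \<times> X" using r(2) by blast
    then show False using X restr[of X] by blast
  next
    case 2
    then have "insert (q, p) L \<inter> Y \<times> Y \<subseteq> r \<inter> Y \<times> Y" using r(2) by blast
    then show False using Y restr[of Y] by blast
  qed
qed

text \<open>Zorn's lemma gives a maximal extendable relation, total by
  \<open>extendable_insert\<close>. Antisymmetry, transitivity and convexity each concern at most
  three points, so they are read off from an order on those points.\<close>

lemma orderable_compactness:
  assumes fin: "\<And>X. finite X \<Longrightarrow> X \<subseteq> \<Omega> \<Longrightarrow> orderable X ((\<lambda>A. A \<inter> X) ` \<P>)"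
  shows "orderable \<Omega> \<P>"
proof -
  have "\<exists>r. linear_order_on X r \<and> {} \<inter> X \<times> X \<subseteq> r \<and> (\<forall>A\<in>\<P>. convex_in r A)"
    if X: "finite X" "X \<subseteq> \<Omega>" for X
  proof -
    obtain r where r: "linear_order_on X r" "\<And>A. A \<in> \<P> \<Longrightarrow> convex_in r (A \<inter> X)"
      using fin[OF X] unfolding orderable_def by blast
    \<comment> \<open>Since \<open>r\<close> relates only points of \<open>X\<close>, a member is
      convex as soon as its trace on \<open>X\<close> is.\<close>
    have "convex_in r A" if "A \<in> \<P>" for A
      using r(2)[OF that] linear_order_on_dom[OF r(1)] unfolding convex_in_def by blast
    then show ?thesis using r(1) by blast
  qed
  then have "extendable \<Omega> \<P> {}" unfolding extendable_def by blast
  then have "\<exists>M\<in>{L. extendable \<Omega> \<P> L}. \<forall>L\<in>{L. extendable \<Omega> \<P> L}. M \<subseteq> L \<longrightarrow> L = M"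
    by (intro subset_Zorn_nonempty) (auto intro: extendable_Union_chain)
  then obtain M where M: "extendable \<Omega> \<P> M"
    and max: "\<And>L. extendable \<Omega> \<P> L \<Longrightarrow> M \<subseteq> L \<Longrightarrow> L = M"
    by blast
  have sub: "M \<subseteq> \<Omega> \<times> \<Omega>" using M unfolding extendable_def by blast
  have total: "(p, q) \<in> M \<or> (q, p) \<in> M" if "p \<in> \<Omega>" "q \<in> \<Omega>" for p q
    using extendable_insert[OF M that] max by blast
  have local: "\<exists>r. linear_order_on {p, q, s} r \<and> M \<inter> {p, q, s} \<times> {p, q, s} \<subseteq> r \<and>
      (\<forall>A\<in>\<P>. convex_in r A)" if "p \<in> \<Omega>" "q \<in> \<Omega>" "s \<in> \<Omega>" for p q s
    using M[unfolded extendable_def, THEN conjunct2, rule_format, of "{p, q, s}"] that by blast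
  have antisym: "p = q" if "(p, q) \<in> M" "(q, p) \<in> M" for p q
  proof -
    have "p \<in> \<Omega>" "q \<in> \<Omega>" using that sub by blast+
    then obtain r where r: "linear_order_on {p, q, q} r" "M \<inter> {p, q, q} \<times> {p, q, q} \<subseteq> r"
      using local[of p q q] by blast
    then have "(p, q) \<in> r" "(q, p) \<in> r" using that by blast+
    then show ?thesis by (rule linear_order_on_antisym[OF r(1)])
  qed
  have trans: "(p, s) \<in> M" if "(p, q) \<in> M" "(q, s) \<in> M" for p q s
  proof (rule ccontr)
    assume no: "(p, s) \<notin> M"
    have \<Omega>: "p \<in> \<Omega>" "q \<in> \<Omega>" "s \<in> \<Omega>" using that sub by blast+
    then have sp: "(s, p) \<in> M" using total no by blast
    obtain r where r: "linear_order_on {p, q, s} r" "M \<inter> {p, q, s} \<times> {p, q, s} \<subseteq> r"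
      using local[OF \<Omega>] by blast
    then have "(p, q) \<in> r" "(q, s) \<in> r" "(s, p) \<in> r" using that sp by blast+
    then have "p = s"
      using linear_order_on_trans[OF r(1)] linear_order_on_antisym[OF r(1)] by blast
    then show False using no sp by blast
  qed
  have "linear_order_on \<Omega> M"
    using sub total antisym trans by (intro linear_order_onI) blast+
  moreover have "convex_in M A" if A: "A \<in> \<P>" for A
    unfolding convex_in_def
  proof (intro allI impI)
    fix p q s assume ps: "p \<in> A" "s \<in> A" and M': "(p, q) \<in> M" "(q, s) \<in> M"
    then have \<Omega>: "p \<in> \<Omega>" "q \<in> \<Omega>" "s \<in> \<Omega>" using sub by blast+
    obtain r where "M \<inter> {p, q, s} \<times> {p, q, s} \<subseteq> r" "convex_in r A"
      using local[OF \<Omega>] A by blast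
    then show "q \<in> A" using convex_inD[of r A p s q] ps M' by blast
  qed
  ultimately show ?thesis unfolding orderable_def by blast
qed

section \<open>From tripods to adjacent triples\<close>

text \<open>The three witnesses against the inclusions make \<open>D\<close>, \<open>E\<close>,
  \<open>F\<close> pairwise overlapping, so they can be cut up inside \<open>\<P>\<close>. Which
  pieces are pairwise adjacent depends on whether \<open>D \<inter> E \<inter> F\<close> is
  empty.\<close>

lemma tripod_free_if_no_adjacent_triple:
  assumes cl: "overlap_closed \<P>"
    and no: "\<not> (\<exists>A\<in>\<P>. \<exists>B\<in>\<P>. \<exists>C\<in>\<P>. A \<noteq> {} \<and> B \<noteq> {} \<and> C \<noteq> {} \<and>
              adjacent \<P> A B \<and> adjacent \<P> B C \<and> adjacent \<P> A C)"
  shows "tripod_free \<P>"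
  unfolding tripod_free_def
proof (intro ballI, rule ccontr)
  fix D E F assume P: "D \<in> \<P>" "E \<in> \<P>" "F \<in> \<P>"
    and contra: "\<not> (D \<inter> E \<subseteq> F \<or> E \<inter> F \<subseteq> D \<or> D \<inter> F \<subseteq> E)"
  have triple: False if "A \<in> \<P>" "B \<in> \<P>" "C \<in> \<P>" "A \<noteq> {}" "B \<noteq> {}" "C \<noteq> {}"
    "A \<inter> B = {}" "B \<inter> C = {}" "C \<inter> A = {}" "A \<union> B \<in> \<P>" "B \<union> C \<in> \<P>" "C \<union> A \<in> \<P>" for A B C
    using no that unfolding adjacent_def by (metis Int_commute Un_commute)
  have int: "S \<inter> T \<in> \<P>" and un: "S \<union> T \<in> \<P>" and diff: "S - T \<in> \<P>"
    if "overlap S T" "S \<in> \<P>" "T \<in> \<P>" for S T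
    using cl that unfolding overlap_closed_def by blast+
  obtain a b c where abc: "a \<in> D" "a \<in> E" "a \<notin> F" "b \<in> E" "b \<in> F" "b \<notin> D"
    "c \<in> D" "c \<in> F" "c \<notin> E"
    using contra by blast
  have ov: "overlap D E" "overlap E F" "overlap F D" "overlap D F"
    using abc unfolding overlap_def by blast+
  show False
  proof (cases "D \<inter> E \<inter> F = {}")
    case True
    \<comment> \<open>The six remaining regions of the Venn diagram form a cycle, here cut into three arcs.\<close>
    have union: "(S - U) \<union> (U - T) \<in> \<P>"
      if "S \<inter> T \<inter> U = {}" "overlap U T" "S \<inter> U \<noteq> {}" "\<not> S \<subseteq> U" "S \<in> \<P>" "T \<in> \<P>" "U \<in> \<P>" for S T U
    proof -
      \<comment> \<open>The part of \<open>S\<close> lost in \<open>S - U\<close> avoids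
        \<open>T\<close>, hence is recovered in \<open>U - T\<close>.\<close>
      have "(S - U) \<union> (U - T) = S \<union> (U - T)" using that(1) by blast
      moreover have "S \<union> (U - T) \<in> \<P>"
      proof (cases "U - T \<subseteq> S")
        case True
        then show ?thesis using that(5) by (simp add: Un_absorb2)
      next
        case False
        then have "overlap S (U - T)" using that(1,3,4) unfolding overlap_def by blast
        then show ?thesis using un diff that by blast
      qed
      ultimately show ?thesis by simp
    qed
    show False
    proof (rule triple[of "D - F" "F - E" "E - D"])
      show "D - F \<in> \<P>" "F - E \<in> \<P>" "E - D \<in> \<P>"
        using diff P ov unfolding overlap_def by blast+
      show "(D - F) \<union> (F - E) \<in> \<P>" "(F - E) \<union> (E - D) \<in> \<P>" "(E - D) \<union> (D - F) \<in> \<P>"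
        using True abc ov P by (intro union; (unfold overlap_def)?; blast)+
    qed (use abc in blast)+
  next
    case False
    \<comment> \<open>The pairwise intersections form a sunflower, whose petals are pairwise adjacent.\<close>
    let ?U = "D \<inter> E" and ?V = "E \<inter> F" and ?W = "D \<inter> F"
    have UVW: "?U \<in> \<P>" "?V \<in> \<P>" "?W \<in> \<P>" using int ov P by blast+
    have ov': "overlap ?U ?V" "overlap ?V ?W" "overlap ?W ?U"
      using abc False unfolding overlap_def by blast+
    have union: "(S - T) \<union> (T - U) \<in> \<P>"
      if "S \<inter> T \<subseteq> U" "overlap S T" "overlap (S \<union> T) U" "S \<inter> U \<subseteq> T" "S \<in> \<P>" "T \<in> \<P>" "U \<in> \<P>" for S T U
    proof -
      \<comment> \<open>In the sunflower, subtracting one set from another removes just the common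
        core. Two petals together are therefore the union of two of the sets minus the
        third.\<close>
      have "(S - T) \<union> (T - U) = (S \<union> T) - U" using that(1,4) by blast
      then show ?thesis using un diff that by metis
    qed
    show False
    proof (rule triple[of "?U - ?V" "?V - ?W" "?W - ?U"])
      show "?U - ?V \<in> \<P>" "?V - ?W \<in> \<P>" "?W - ?U \<in> \<P>"
        using diff UVW ov' by blast+
      have "overlap (?U \<union> ?V) ?W" "overlap (?V \<union> ?W) ?U" "overlap (?W \<union> ?U) ?V"
        using abc False unfolding overlap_def by blast+
      then show "(?U - ?V) \<union> (?V - ?W) \<in> \<P>" "(?V - ?W) \<union> (?W - ?U) \<in> \<P>"
        "(?W - ?U) \<union> (?U - ?V) \<in> \<P>"
        using UVW ov' by (intro union; blast)+
    qed (use abc in blast)+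
  qed
qed

section \<open>Adjacent triples obstruct convex orders\<close>

lemma linear_order_on_three_middle:
  assumes "linear_order_on X r" "a \<in> X" "b \<in> X" "c \<in> X"
  obtains "(a, b) \<in> r" "(b, c) \<in> r" | "(c, b) \<in> r" "(b, a) \<in> r"
    | "(b, a) \<in> r" "(a, c) \<in> r" | "(c, a) \<in> r" "(a, b) \<in> r"
    | "(a, c) \<in> r" "(c, b) \<in> r" | "(b, c) \<in> r" "(c, a) \<in> r"
  using linear_order_on_total[OF assms(1)] assms(2-) by metis

text \<open>Of one point from each set, one lies between the other two. The convex union of the two
  sets containing the outer points then contains the middle one, against disjointness.\<close>

lemma no_adjacent_triple_if_orderable:
  assumes r: "linear_order_on X r" and conv: "\<And>A. A \<in> \<P> \<Longrightarrow> convex_in r A"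
    and sub: "\<P> \<subseteq> Pow X"
    and adj: "adjacent \<P> A B" "adjacent \<P> B C" "adjacent \<P> A C"
    and ne: "A \<noteq> {}" "B \<noteq> {}" "C \<noteq> {}"
  shows False
proof -
  obtain a b c where abc: "a \<in> A" "b \<in> B" "c \<in> C" using ne by blast
  have X: "a \<in> X" "b \<in> X" "c \<in> X" using abc adj sub unfolding adjacent_def by blast+
  have disj: "A \<inter> B = {}" "B \<inter> C = {}" "A \<inter> C = {}"
    and "convex_in r (A \<union> B)" "convex_in r (B \<union> C)" "convex_in r (A \<union> C)"
    using adj conv unfolding adjacent_def by blast+
  then have mid: "(a, b) \<in> r \<Longrightarrow> (b, c) \<in> r \<Longrightarrow> False" "(c, b) \<in> r \<Longrightarrow> (b, a) \<in> r \<Longrightarrow> False"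
    "(b, a) \<in> r \<Longrightarrow> (a, c) \<in> r \<Longrightarrow> False" "(c, a) \<in> r \<Longrightarrow> (a, b) \<in> r \<Longrightarrow> False"
    "(a, c) \<in> r \<Longrightarrow> (c, b) \<in> r \<Longrightarrow> False" "(b, c) \<in> r \<Longrightarrow> (c, a) \<in> r \<Longrightarrow> False"
    using abc by (auto dest: convex_inD)
  show False
    by (rule linear_order_on_three_middle[OF r X]) (fact mid)+
qed

theorem theorem5p1:
  fixes \<Omega> :: "'a set" and \<P> :: "'a set set"
  assumes "patchwork \<Omega> \<P>"
  shows "(\<exists>r. linear_order_on \<Omega> r \<and> (\<forall>A\<in>\<P>. convex_in r A)) \<longleftrightarrow>
         \<not> (\<exists>A\<in>\<P>. \<exists>B\<in>\<P>. \<exists>C\<in>\<P>. A \<noteq> {} \<and> B \<noteq> {} \<and> C \<noteq> {} \<and>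
              adjacent \<P> A B \<and> adjacent \<P> B C \<and> adjacent \<P> A C)"
    (is "?ordered \<longleftrightarrow> ?no_triple")
proof
  have sub: "\<P> \<subseteq> Pow \<Omega>" and cl: "overlap_closed \<P>"
    using assms unfolding patchwork_def overlap_closed_def by blast+
  show ?no_triple if ?ordered
  proof -
    obtain r where r: "linear_order_on \<Omega> r" "\<And>A. A \<in> \<P> \<Longrightarrow> convex_in r A" using \<open>?ordered\<close> by blast
    show ?thesis using no_adjacent_triple_if_orderable[OF r sub] by blast
  qed
  show ?ordered if ?no_triple
  proof -
    have tf: "tripod_free \<P>" using tripod_free_if_no_adjacent_triple[OF cl that] .
    have "orderable X ((\<lambda>A. A \<inter> X) ` \<P>)" if "finite X" for X
      using that overlap_closed_trace[OF cl] tripod_free_trace[OF tf]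
      by (intro orderable_finite) auto
    then have "orderable \<Omega> \<P>" by (rule orderable_compactness)
    then show ?thesis unfolding orderable_def .
  qed
qed

end
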